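(* Let $R$ and $S$ be finite rings. If some prime factor of $|S|$ is not a factor of $|R|$, then there exists a network $\mathcal{N}$ such that $\mathcal{C}_{lin}(\mathcal{N},R) > \mathcal{C}_{lin}(\mathcal{N},S)$.
   Context: Rings are associative with identity $1$, not necessarily commutative. Rings used as alphabets have at least two elements. A network is a finite directed acyclic multigraph, some of whose nodes are sources or receivers, with finitely many message vectors (say $m$ of them), each originating at a source node; each receiver demands a specified set of the message vectors. The inputs of a node are the message vectors originating at the node together with the vectors carried by its incoming edges. For integers $k_1,\dots,k_m\ge 0$ and $n\ge 1$, a $(k_1,\dots,k_m,n)$ code over a finite alphabet $\mathcal{A}$ (with $|\mathcal{A}|\ge 2$) lets the $i$th message vector range over $\mathcal{A}^{k_i}$, assigns to each edge an edge function mapping the inputs of the edge's tail node to a vector in $\mathcal{A}^n$ (the vector carried by the edge), and assigns to each receiver and each message vector it demands a decoding function of the receiver's inputs. The code is a solution if, for all values of the message vectors, each decoding function outputs the demanded message vector. Its rate vector is $(k_1/n,\dots,k_m/n)$. For a finite ring $R$, a code over the alphabet $R$ is two-sided linear if every component of every edge function and decoding function, as a function of the components $x_1,\dots,x_s\in R$ of the node's input vectors, has the form $\sum_{i=1}^{s}\sum_{j=1}^{n_i} a_{i,j}\,x_i\,b_{i,j}$ with $a_{i,j},b_{i,j}\in R$. (Equivalently, it is linear over $R$ viewed as a left module over $R\otimes_{\mathbb{Z}}R^{op}$ with $\left(\sum_i a_i\otimes b_i\right)\cdot x=\sum_i a_i x b_i$; for commutative $R$ this is the same as ordinary linearity $\mathbf{x}\mapsto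 A\mathbf{x}$ with $A$ a matrix over $R$.) A rate vector $\mathbf{r}$ is linearly achievable for $\mathcal{N}$ over $R$ if $\mathcal{N}$ has a two-sided linear solution over $R$ (for some block sizes) with rate vector $\mathbf{r}$, and $\mathcal{C}_{lin}(\mathcal{N},R)=\sup\{r\in\mathbb{Q} : (r,\dots,r)\text{ is linearly achievable for }\mathcal{N}\text{ over }R\}$ (a supremum in the extended reals). *)

theory Defs
  imports
    "Graph_Theory.Digraph"
    "HOL-Library.FuncSet"
    "HOL-Library.Cardinality"
    "HOL-Library.Extended_Real"
    "HOL-Computational_Algebra.Primes"
begin

section \<open>Networks\<close>

text \<open>
  The message vectors are numbered \<open>0, \<dots>, num_messages N - 1\<close>; message \<open>i\<close> originates at the
  node \<open>origin N i\<close>, and the receiver \<open>v\<close> demands the messages with index in \<open>demands N v\<close>.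
  Arcs of a \<open>pre_digraph\<close> have their own identity, so parallel edges are allowed.
\<close>

record ('v, 'e) network =
  dag :: "('v, 'e) pre_digraph"
  sources :: "'v set"
  receivers :: "'v set"
  num_messages :: nat
  origin :: "nat \<Rightarrow> 'v"
  demands :: "'v \<Rightarrow> nat set"

definition is_network :: "('v, 'e) network \<Rightarrow> bool" where
  "is_network N \<longleftrightarrow>
     fin_digraph (dag N) \<and> acyclic (arcs_ends (dag N)) \<and>
     sources N \<subseteq> verts (dag N) \<and> receivers N \<subseteq> verts (dag N) \<and>
     (\<forall>i < num_messages N. origin N i \<in> sources N) \<and>
     (\<forall>v \<in> receivers N. demands N v \<subseteq> {..<num_messages N})"

datatype 'e input = Message nat | Edge 'e

definition inputs :: "('v, 'e) network \<Rightarrow> 'v \<Rightarrow> 'e input set" where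
  "inputs N v =
     Message ` {i. i < num_messages N \<and> origin N i = v} \<union> Edge ` in_arcs (dag N) v"

section \<open>Codes\<close>

text \<open>
  Throughout, \<open>k i\<close> is the length of the \<open>i\<close>th message vector (only \<open>i < num_messages N\<close> matters)
  and \<open>n\<close> the length of the vectors carried by the edges.  The alphabet is the type \<open>'a\<close>, and a
  vector of length \<open>d\<close> is an extensional function on \<open>{..<d}\<close>.
\<close>

definition vectors :: "nat \<Rightarrow> (nat \<Rightarrow> 'a) set" where
  "vectors d = {..<d} \<rightarrow>\<^sub>E UNIV"

fun input_dim :: "(nat \<Rightarrow> nat) \<Rightarrow> nat \<Rightarrow> 'e input \<Rightarrow> nat" where
  "input_dim k n (Message i) = k i"
| "input_dim k n (Edge e) = n"

definition input_space ::
    "('v, 'e) network \<Rightarrow> (nat \<Rightarrow> nat) \<Rightarrow> nat \<Rightarrow> 'v \<Rightarrow> ('e input \<Rightarrow> nat \<Rightarrow> 'a) set" where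
  "input_space N k n v = (\<Pi>\<^sub>E u \<in> inputs N v. vectors (input_dim k n u))"

record ('v, 'e, 'a) code =
  edge_fun :: "'e \<Rightarrow> ('e input \<Rightarrow> nat \<Rightarrow> 'a) \<Rightarrow> (nat \<Rightarrow> 'a)"
  decode_fun :: "'v \<Rightarrow> nat \<Rightarrow> ('e input \<Rightarrow> nat \<Rightarrow> 'a) \<Rightarrow> (nat \<Rightarrow> 'a)"

definition is_code ::
    "('v, 'e) network \<Rightarrow> (nat \<Rightarrow> nat) \<Rightarrow> nat \<Rightarrow> ('v, 'e, 'a) code \<Rightarrow> bool" where
  "is_code N k n C \<longleftrightarrow> n \<ge> 1 \<and>
     (\<forall>e \<in> arcs (dag N). edge_fun C e \<in> input_space N k n (tail (dag N) e) \<rightarrow> vectors n) \<and>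
     (\<forall>v \<in> receivers N. \<forall>i \<in> demands N v.
        decode_fun C v i \<in> input_space N k n v \<rightarrow> vectors (k i))"

text \<open>
  \<open>x\<close> gives the values of the messages and \<open>z\<close> the vectors carried by the edges.
\<close>

definition node_input ::
    "('v, 'e) network \<Rightarrow> (nat \<Rightarrow> nat \<Rightarrow> 'a) \<Rightarrow> ('e \<Rightarrow> nat \<Rightarrow> 'a) \<Rightarrow> 'v \<Rightarrow> ('e input \<Rightarrow> nat \<Rightarrow> 'a)" where
  "node_input N x z v =
     (\<lambda>u \<in> inputs N v. case u of Message i \<Rightarrow> x i | Edge e \<Rightarrow> z e)"

definition carried ::
    "('v, 'e) network \<Rightarrow> ('v, 'e, 'a) code \<Rightarrow> (nat \<Rightarrow> nat \<Rightarrow> 'a) \<Rightarrow> ('e \<Rightarrow> nat \<Rightarrow> 'a) \<Rightarrow> bool" where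
  "carried N C x z \<longleftrightarrow>
     (\<forall>e \<in> arcs (dag N). z e = edge_fun C e (node_input N x z (tail (dag N) e)))"

text \<open>
  As the graph is finite and acyclic, the messages determine the carried vectors: see
  \<open>ex1_carried\<close> below.  So the quantification over \<open>z\<close> is neither vacuous nor a
  strengthening.
\<close>

definition is_solution ::
    "('v, 'e) network \<Rightarrow> (nat \<Rightarrow> nat) \<Rightarrow> nat \<Rightarrow> ('v, 'e, 'a) code \<Rightarrow> bool" where
  "is_solution N k n C \<longleftrightarrow> is_code N k n C \<and>
     (\<forall>x \<in> (\<Pi>\<^sub>E i \<in> {..<num_messages N}. vectors (k i)). \<forall>z. carried N C x z \<longrightarrow>
        (\<forall>v \<in> receivers N. \<forall>i \<in> demands N v. decode_fun C v i (node_input N x z v) = x i))"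

lemma node_input_cong:
  assumes "\<And>e. e \<in> in_arcs (dag N) v \<Longrightarrow> z e = z' e"
  shows "node_input N x z v = node_input N x z' v"
  using assms by (auto simp: node_input_def inputs_def restrict_def fun_eq_iff)

lemma ex1_carried:
  assumes "is_network N"
  shows "\<exists>!z. z \<in> extensional (arcs (dag N)) \<and> carried N C x z"
proof -
  let ?G = "dag N"
  define r where "r = {(d, e). d \<in> arcs ?G \<and> head ?G d = tail ?G e}"
  have "finite (arcs_ends ?G)"
    using assms by (auto simp: is_network_def arcs_ends_def fin_digraph.finite_arcs)
  then have "wf (inv_image (arcs_ends ?G) (tail ?G))"
    using assms by (intro wf_inv_image finite_acyclic_wf) (auto simp: is_network_def)
  moreover have "r \<subseteq> inv_image (arcs_ends ?G) (tail ?G)"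
    by (force simp: r_def arcs_ends_conv)
  ultimately have wf: "wf r"
    by (rule wf_subset)
  define F where "F z e = edge_fun C e (node_input N x z (tail ?G e))" for z e
  have F_cong: "F z e = F z' e" if "\<And>d. (d, e) \<in> r \<Longrightarrow> z d = z' d" for z z' e
  proof -
    have "node_input N x z (tail ?G e) = node_input N x z' (tail ?G e)"
      by (rule node_input_cong) (use that in \<open>auto simp: r_def in_arcs_def\<close>)
    then show ?thesis
      by (simp add: F_def)
  qed
  define w where "w = wfrec r F"
  have "adm_wf r F"
    unfolding adm_wf_def using F_cong by blast
  then have w: "w e = F w e" for e
    unfolding w_def by (rule wfrec_fixpoint[OF wf, THEN fun_cong])
  show ?thesis
  proof (rule ex1I[of _ "restrict w (arcs ?G)"])
    have "F (restrict w (arcs ?G)) e = F w e" for e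
      by (rule F_cong) (auto simp: r_def)
    then show "restrict w (arcs ?G) \<in> extensional (arcs ?G) \<and> carried N C x (restrict w (arcs ?G))"
      using w by (simp add: carried_def flip: F_def)
  next
    fix z
    assume z: "z \<in> extensional (arcs ?G) \<and> carried N C x z"
    have "e \<in> arcs ?G \<longrightarrow> z e = w e" for e
    proof (induction e rule: wf_induct_rule[OF wf])
      case (1 e)
      have "F z e = F w e"
        by (rule F_cong) (use 1 in \<open>auto simp: r_def\<close>)
      then show ?case
        using z w[of e] by (simp add: carried_def flip: F_def)
    qed
    then show "z = restrict w (arcs ?G)"
      using z by (auto simp: fun_eq_iff extensional_def restrict_def)
  qed
qed

section \<open>Two-sided linear codes\<close>

text \<open>
  \<open>two_sided_linear I d m f\<close>: on families \<open>x\<close> of vectors indexed by \<open>I\<close>, where \<open>x u\<close> has length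
  \<open>d u\<close>, each of the \<open>m\<close> components of \<open>f x\<close> is a sum of terms \<open>a x\<^sub>u\<^sub>j b\<close>, with \<open>L u j\<close> terms
  for the input component \<open>x\<^sub>u\<^sub>j\<close>.
\<close>

definition two_sided_linear ::
    "'i set \<Rightarrow> ('i \<Rightarrow> nat) \<Rightarrow> nat \<Rightarrow> (('i \<Rightarrow> nat \<Rightarrow> 'a::ring_1) \<Rightarrow> (nat \<Rightarrow> 'a)) \<Rightarrow> bool" where
  "two_sided_linear I d m f \<longleftrightarrow>
     (\<forall>t < m. \<exists>(L :: 'i \<Rightarrow> nat \<Rightarrow> nat) a b. \<forall>x \<in> (\<Pi>\<^sub>E u \<in> I. vectors (d u)).
        f x t = (\<Sum>u \<in> I. \<Sum>j < d u. \<Sum>l < L u j. a u j l * x u j * b u j l))"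

definition two_sided_linear_code ::
    "('v, 'e) network \<Rightarrow> (nat \<Rightarrow> nat) \<Rightarrow> nat \<Rightarrow> ('v, 'e, 'a::ring_1) code \<Rightarrow> bool" where
  "two_sided_linear_code N k n C \<longleftrightarrow>
     (\<forall>e \<in> arcs (dag N).
        two_sided_linear (inputs N (tail (dag N) e)) (input_dim k n) n (edge_fun C e)) \<and>
     (\<forall>v \<in> receivers N. \<forall>i \<in> demands N v.
        two_sided_linear (inputs N v) (input_dim k n) (k i) (decode_fun C v i))"

text \<open>
  Finite rings are types of class \<open>{finite, ring_1}\<close>, not assumed commutative; \<open>ring_1\<close> has
  \<open>0 \<noteq> 1\<close>, so the alphabet has at least two elements.
\<close>

definition linearly_achievable ::
    "'a::{finite, ring_1} itself \<Rightarrow> ('v, 'e) network \<Rightarrow> (nat \<Rightarrow> rat) \<Rightarrow> bool" where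
  "linearly_achievable R N r \<longleftrightarrow>
     (\<exists>k n (C :: ('v, 'e, 'a) code).
        is_solution N k n C \<and> two_sided_linear_code N k n C \<and>
        (\<forall>i < num_messages N. r i = of_nat (k i) / of_nat n))"

definition linear_capacity :: "'a::{finite, ring_1} itself \<Rightarrow> ('v, 'e) network \<Rightarrow> ereal" where
  "linear_capacity R N =
     Sup {ereal (real_of_rat r) | r. linearly_achievable R N (\<lambda>i. r)}"

end

theory Submission
  imports
    Defs
    "HOL-Algebra.Sylow"
    "HOL-Number_Theory.Residues"
    "HOL-Library.Function_Algebras"
begin

text \<open>
  Let \<open>p\<close> be a prime dividing \<open>|S|\<close> but not \<open>|R|\<close>.  The network has messages \<open>x\<^sub>0, \<dots>, x\<^sub>p\<close>, one
  bottleneck \<open>w\<close> that sees all of them, and for each \<open>i\<close> a bottleneck \<open>y\<^sub>i\<close> that sees all but \<open>x\<^sub>i\<close>;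
  \<open>x\<^sub>i\<close> is demanded from \<open>w\<close> and \<open>y\<^sub>i\<close>, and \<open>x\<^sub>0\<close> from all the \<open>y\<^sub>i\<close> together.  If every edge carries
  the sum of its inputs, then \<open>x\<^sub>i = w - y\<^sub>i\<close> and \<open>y\<^sub>0 + \<dots> + y\<^sub>p = p w\<close>, so rate 1 is achieved over \<open>R\<close>,
  where \<open>p\<close> is invertible.

  Over \<open>S\<close>, a two-sided linear solution restricts to one by additive maps over the nonzero group
  \<open>A = {a. p a = 0}\<close>.  Decodability from \<open>w\<close> and \<open>y\<^sub>i\<close> at a rate near 1 forces \<open>y\<^sub>i\<close> to be nearly a function
  of \<open>w\<close> on the messages with \<open>x\<^sub>i = 0\<close>; as \<open>p A = 0\<close>, there are then many messages on which every \<open>y\<^sub>i\<close>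
  is nearly constant, although they have different \<open>x\<^sub>0\<close>.  Counting group elements gives the rate bound
  \<open>1 - 1 / (3 (p + 1))\<close>.
\<close>

section \<open>Counting in finite abelian groups\<close>

definition subgroup_of :: "'a::ab_group_add set \<Rightarrow> bool" where
  "subgroup_of G \<longleftrightarrow> 0 \<in> G \<and> (\<forall>x \<in> G. \<forall>y \<in> G. x - y \<in> G)"

lemma subgroup_ofD:
  assumes "subgroup_of G"
  shows "0 \<in> G"
    and "x \<in> G \<Longrightarrow> y \<in> G \<Longrightarrow> x - y \<in> G"
    and "x \<in> G \<Longrightarrow> y \<in> G \<Longrightarrow> x + y \<in> G"
proof -
  show "x + y \<in> G" if "x \<in> G" "y \<in> G"
  proof -
    have "x - (0 - y) \<in> G"
      using assms that by (simp only: subgroup_of_def)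
    then show ?thesis
      by simp
  qed
qed (use assms in \<open>auto simp: subgroup_of_def\<close>)

text \<open>The nonempty fibres of \<open>f\<close> on \<open>G\<close> are translates of the
  kernel, hence all equally large.\<close>

lemma card_image_times_kernel:
  assumes "additive f" "subgroup_of G" "finite G"
  shows "card G = card (f ` G) * card {x \<in> G. f x = 0}"
proof -
  interpret additive f by fact
  have "card {x \<in> G. f x = y} = card {x \<in> G. f x = 0}" if y: "y \<in> f ` G" for y
  proof -
    obtain g where g: "g \<in> G" "y = f g"
      using y by auto
    have "bij_betw (\<lambda>x. x + g) {x \<in> G. f x = 0} {x \<in> G. f x = y}"
      by (rule bij_betw_byWitness[where f' = "\<lambda>x. x - g"])
        (use g assms(2) in \<open>auto simp: add diff subgroup_ofD\<close>)
    from bij_betw_same_card[OF this] show ?thesis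
      by simp
  qed
  then have "card (f ` G) * card {x \<in> G. f x = 0} = (\<Sum>y \<in> f ` G. card {x \<in> G. f x = y})"
    by simp
  also have "\<dots> = card (\<Union>y \<in> f ` G. {x \<in> G. f x = y})"
    by (rule card_UN_disjoint[symmetric]) (use assms(3) in auto)
  also have "(\<Union>y \<in> f ` G. {x \<in> G. f x = y}) = G"
    by auto
  finally show ?thesis ..
qed

text \<open>Read as a cost estimate: imposing the additive condition \<open>f x = 0\<close> shrinks
  a group by at most the factor \<open>card T\<close>.\<close>

lemma card_le_kernel:
  assumes "additive f" "subgroup_of G" "finite G" "f ` G \<subseteq> T" "finite T"
  shows "card G \<le> card T * card {x \<in> G. f x = 0}"
  using card_image_times_kernel[OF assms(1-3)] card_mono[OF assms(5,4)] by simp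

text \<open>The value outside \<open>I\<close> is \<open>0\<close> rather than
  \<open>undefined\<close>, so that tuples over a subgroup form a subgroup of the function type
  under pointwise operations.\<close>

definition tuples :: "'i set \<Rightarrow> 'a::zero set \<Rightarrow> ('i \<Rightarrow> 'a) set" where
  "tuples I B = {f. (\<forall>i \<in> I. f i \<in> B) \<and> (\<forall>i. i \<notin> I \<longrightarrow> f i = 0)}"

lemma bij_betw_tuples: "bij_betw (\<lambda>f. restrict f I) (tuples I B) (I \<rightarrow>\<^sub>E B)"
  by (rule bij_betw_byWitness[where f' = "\<lambda>f i. if i \<in> I then f i else 0"])
    (auto simp: tuples_def fun_eq_iff PiE_iff extensional_def)

lemma card_tuples: "finite I \<Longrightarrow> card (tuples I B) = card B ^ card I"
  using bij_betw_same_card[OF bij_betw_tuples, of I B] by (simp add: card_funcsetE)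

lemma finite_tuples: "finite I \<Longrightarrow> finite B \<Longrightarrow> finite (tuples I B)"
  using bij_betw_finite[OF bij_betw_tuples, of I B] by (simp add: finite_PiE)

lemma subgroup_of_tuples: "subgroup_of B \<Longrightarrow> subgroup_of (tuples I B)"
  by (auto simp: subgroup_of_def tuples_def)

definition single :: "'i \<Rightarrow> 'a::zero \<Rightarrow> 'i \<Rightarrow> 'a" where
  "single i a j = (if j = i then a else 0)"

lemma single_simps [simp]: "single i a i = a" "j \<noteq> i \<Longrightarrow> single i a j = 0" "single i 0 = 0"
  by (auto simp: single_def)

lemma single_add: "single i (a + b :: 'a::ab_group_add) = single i a + single i b"
  and single_diff: "single i (a - b :: 'a::ab_group_add) = single i a - single i b"
  by (auto simp: single_def)

lemma single_in_tuples: "subgroup_of B \<Longrightarrow> i \<in> I \<Longrightarrow> a \<in> B \<Longrightarrow> single i a \<in> tuples I B"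
  by (auto simp: tuples_def subgroup_of_def single_def)

lemma tuples_eq_sum_single:
  assumes "finite I" "x \<in> tuples I B"
  shows "x = (\<Sum>i\<in>I. single i (x i))"
proof
  fix j
  have "(\<Sum>i\<in>I. single i (x i)) j = (\<Sum>i\<in>I. single i (x i) j)"
    using \<open>finite I\<close> by (induction I) auto
  also have "\<dots> = x j"
    using assms by (auto simp: tuples_def single_def)
  finally show "x j = (\<Sum>i\<in>I. single i (x i)) j" ..
qed

text \<open>This is the network reduced to additive maps: by additivity, decodability becomes a
  statement about kernels (\<open>dec\<close>, \<open>dec0\<close>). The bound is the product of
  \<open>card M \<le> card Y ^ p * card K\<close>, of
  \<open>card K \<le> (\<Prod>i\<le>p. card (V i))\<close> and, for each \<open>i \<le> p\<close>,
  of \<open>card (V i) * card X ^ 2 \<le> card Y ^ 2\<close>.\<close>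

lemma broadcast_bound:
  fixes p :: nat and X :: "'a::ab_group_add set" and Y :: "'b::ab_group_add set"
    and w :: "(nat \<Rightarrow> 'a) \<Rightarrow> 'b" and y :: "nat \<Rightarrow> (nat \<Rightarrow> 'a) \<Rightarrow> 'b"
  defines "M \<equiv> tuples {..p} X"
  assumes p: "p \<ge> 1" "\<And>c. c \<in> Y \<Longrightarrow> (\<Sum>i<p. c) = 0"
    and X: "subgroup_of X" "finite X" and Y: "subgroup_of Y" "finite Y"
    and w: "additive w" "w ` M \<subseteq> Y"
    and y: "\<And>i. i \<le> p \<Longrightarrow> additive (y i)" "\<And>i. i \<le> p \<Longrightarrow> y i ` M \<subseteq> Y"
    and y_single: "\<And>i a. i \<le> p \<Longrightarrow> a \<in> X \<Longrightarrow> y i (single i a) = 0"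
    and dec: "\<And>x i. x \<in> M \<Longrightarrow> i \<le> p \<Longrightarrow> w x = 0 \<Longrightarrow> y i x = 0 \<Longrightarrow> x i = 0"
    and dec0: "\<And>x. x \<in> M \<Longrightarrow> (\<And>i. i \<le> p \<Longrightarrow> y i x = 0) \<Longrightarrow> x 0 = 0"
  shows "card X ^ (3 * (p + 1)) \<le> card Y ^ (3 * (p + 1) - 1)"
proof -
  interpret w: additive w by fact
  have addy: "y i (x + x') = y i x + y i x'" "y i (x - x') = y i x - y i x'" "y i 0 = 0" if "i \<le> p" for i x x'
    using y(1)[OF that] by (simp_all add: additive.add additive.diff additive.zero)
  have M: "subgroup_of M" "finite M" "card M = card X ^ (p + 1)"
    using X by (auto simp: M_def subgroup_of_tuples finite_tuples card_tuples)
  have single: "single i a \<in> M" if "i \<le> p" "a \<in> X" for i a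
    using that X by (simp add: M_def single_in_tuples)
  have MX: "x i \<in> X" if "x \<in> M" "i \<le> p" for x i
    using that by (auto simp: M_def tuples_def)
  have Msum: "x = (\<Sum>i\<le>p. single i (x i))" if "x \<in> M" for x
    using that unfolding M_def by (intro tuples_eq_sum_single) auto
  have wY: "w (single i (x i)) \<in> Y" if "x \<in> M" "i \<le> p" for x i
    using w(2) single[OF that(2) MX[OF that]] by auto
  \<comment> \<open>Since \<open>y i\<close> does not see coordinate \<open>i\<close>, a message
    supported there must be recoverable from \<open>w\<close> alone.\<close>
  have w_inj: "a = 0" if "i \<le> p" "a \<in> X" "w (single i a) = 0" for i a
    using dec[OF single[OF that(1,2)] that(1) that(3)] y_single that by simp
  \<comment> \<open>The tuples whose coordinates all have the same image \<open>c\<close> under \<open>w\<close> form a large subgroup \<open>K\<close>.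
    On it \<open>w x = (p + 1) c = c\<close>, so deleting the \<open>i\<close>th coordinate gives an element of \<open>ker w\<close>
    with the same \<open>y i\<close>; hence \<open>y i x\<close> lies in the small group \<open>V i\<close>.\<close>
  define V where "V i = y i ` {x \<in> M. x i = 0 \<and> w x = 0}" for i
  have V: "card (V i) * card X ^ 2 \<le> card Y ^ 2" if i: "i \<le> p" for i
  proof -
    \<comment> \<open>By \<open>dec\<close> the joint kernel \<open>L\<close> of \<open>w\<close>
      and \<open>y i\<close> lies in \<open>P\<close>, so it is the kernel of \<open>y i\<close> on
      \<open>P\<close>, and \<open>card P = card (V i) * card L\<close>. Estimating
      \<open>card M\<close> from above through \<open>L\<close> and from below through
      \<open>P\<close>, the factor \<open>card L\<close> cancels.\<close>
    define L where "L = {x \<in> M. y i x = 0 \<and> w x = 0}"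
    define P where "P = {x \<in> M. x i = 0 \<and> w x = 0}"
    have "L \<subseteq> P"
      using dec i by (auto simp: L_def P_def)
    have subP: "subgroup_of P"
      using M(1) by (auto simp: P_def subgroup_of_def w.diff w.zero)
    have "finite P"
      using M(2) by (auto simp: P_def)
    have "card M \<le> card Y * card {x \<in> M. y i x = 0}"
      by (rule card_le_kernel) (use M Y y i in auto)
    also have "card {x \<in> M. y i x = 0} \<le> card Y * card {x \<in> {x \<in> M. y i x = 0}. w x = 0}"
      by (rule card_le_kernel)
        (use M Y w i in \<open>auto simp: subgroup_of_def addy\<close>)
    also have "{x \<in> {x \<in> M. y i x = 0}. w x = 0} = L"
      by (auto simp: L_def)
    finally have L: "card M \<le> card Y ^ 2 * card L"
      by (simp add: power2_eq_square mult.assoc)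
    have "card P = card (V i) * card {x \<in> P. y i x = 0}"
      using card_image_times_kernel[OF y(1)[OF i] subP \<open>finite P\<close>] by (simp add: V_def P_def)
    also have "{x \<in> P. y i x = 0} = L"
      using \<open>L \<subseteq> P\<close> by (auto simp: L_def P_def)
    finally have P: "card P = card (V i) * card L" .
    obtain j where j: "j \<le> p" "j \<noteq> i"
      using p(1) that[of 0] that[of 1] by (cases "i = 0") auto
    \<comment> \<open>Two more coordinates can be added freely to \<open>P\<close>: coordinate
      \<open>i\<close> of the sum reveals \<open>a\<close>, as elements of \<open>P\<close> vanish
      there, and then \<open>w\<close>, which vanishes on \<open>P\<close>, reveals \<open>b\<close>
      by \<open>w_inj\<close>.\<close>
    define h :: "(nat \<Rightarrow> 'a) \<times> 'a \<times> 'a \<Rightarrow> nat \<Rightarrow> 'a"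
      where "h = (\<lambda>(x, a, b). x + single i a + single j b)"
    have "inj_on h (P \<times> X \<times> X)"
    proof (rule inj_onI)
      fix s t assume st: "s \<in> P \<times> X \<times> X" "t \<in> P \<times> X \<times> X" "h s = h t"
      obtain x a b where [simp]: "s = (x, a, b)"
        by (cases s)
      obtain x' a' b' where [simp]: "t = (x', a', b')"
        by (cases t)
      have eq: "x + single i a + single j b = x' + single i a' + single j b'"
        using st by (simp add: h_def)
      have "x i = 0" "x' i = 0" "w x = 0" "w x' = 0"
        using st by (auto simp: P_def)
      then have aa: "a' = a"
        using fun_cong[OF eq, of i] j by simp
      have "x + single j b = x' + single j b'"
        using eq unfolding aa by (simp add: algebra_simps)
      then have "w (x + single j b) = w (x' + single j b')"
        by simp
      then have "w (single j b - single j b') = 0"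
        using \<open>w x = 0\<close> \<open>w x' = 0\<close> by (simp add: w.add w.diff)
      also have "single j b - single j b' = single j (b - b')"
        by (simp add: single_diff)
      finally have bb: "b' = b"
        using w_inj[of j "b - b'"] st j subgroup_ofD(2)[OF X(1)] by simp
      have "x = x'"
        using eq unfolding aa bb by simp
      then show "s = t"
        using aa bb by simp
    qed
    moreover have "h ` (P \<times> X \<times> X) \<subseteq> M"
      using i j M(1) by (auto simp: h_def P_def intro!: subgroup_ofD(3) single)
    ultimately have "card (P \<times> X \<times> X) \<le> card M"
      using M(2) card_inj_on_le by blast
    then have "card (V i) * card X ^ 2 * card L \<le> card M"
      by (simp add: card_cartesian_product P power2_eq_square mult_ac)
    also note L
    finally have "card (V i) * card X ^ 2 * card L \<le> card Y ^ 2 * card L" .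
    moreover have "card L > 0"
      using M(2) subgroup_ofD(1)[OF M(1)] addy(3)[OF i] w.zero by (auto simp: L_def card_gt_0_iff)
    ultimately show ?thesis
      by (simp only: mult_le_cancel2)
  qed
  \<comment> \<open>Comparing with coordinate 0 expresses the equality of \<open>p + 1\<close>
    images by only \<open>p\<close> conditions. The factor \<open>card Y\<close> saved here is what
    pushes the rate below 1.\<close>
  define g where "g x = (\<lambda>j. if j \<in> {1..p} then w (single 0 (x 0)) - w (single j (x j)) else 0)" for x
  have "additive g"
    by standard (auto simp: g_def fun_eq_iff single_add w.add)
  define K where "K = {x \<in> M. g x = 0}"
  have "card M \<le> card (tuples {1..p} Y) * card K"
    unfolding K_def
  proof (rule card_le_kernel)
    show "g ` M \<subseteq> tuples {1..p} Y"
      by (auto simp: tuples_def g_def intro!: subgroup_ofD(2)[OF Y(1)] wY)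
  qed (use M Y \<open>additive g\<close> in \<open>auto simp: finite_tuples\<close>)
  then have MK: "card M \<le> card Y ^ p * card K"
    by (simp add: card_tuples)
  have KW: "w (single i (x i)) = w (single 0 (x 0))" if "x \<in> K" "i \<le> p" for x i
  proof (cases "i = 0")
    case False
    have "g x i = 0"
      using that by (simp add: K_def)
    then show ?thesis
      using False that by (simp add: g_def)
  qed simp
  have yV: "y i x \<in> V i" if "x \<in> K" "i \<le> p" for x i
  proof -
    have "x \<in> M"
      using that by (simp add: K_def)
    define x' where "x' = x - single i (x i)"
    have "w x = (\<Sum>j\<le>p. w (single j (x j)))"
      using arg_cong[OF Msum[OF \<open>x \<in> M\<close>], of w] by (simp only: w.sum)
    also have "\<dots> = (\<Sum>j\<le>p. w (single 0 (x 0)))"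
      by (rule sum.cong[OF refl], rule KW[OF \<open>x \<in> K\<close>]) simp
    also have "\<dots> = w (single 0 (x 0)) + (\<Sum>j<p. w (single 0 (x 0)))"
      by (simp add: lessThan_Suc_atMost[symmetric])
    also have "\<dots> = w (single i (x i))"
      using KW[OF that] p(2)[OF wY[OF \<open>x \<in> M\<close>, of 0]] by simp
    finally have "w x' = 0"
      by (simp add: x'_def w.diff)
    moreover have "x' \<in> M" "x' i = 0"
      using \<open>x \<in> M\<close> MX single that by (auto simp: x'_def intro!: subgroup_ofD(2)[OF M(1)])
    moreover have "y i x = y i x'"
      using that MX[OF \<open>x \<in> M\<close>] by (simp add: x'_def addy y_single)
    ultimately show ?thesis
      by (auto simp: V_def)
  qed
  have finV: "finite (V i)" for i
    using M(2) by (simp add: V_def)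
  \<comment> \<open>An element of \<open>K\<close> on which all \<open>y i\<close> vanish has
    coordinate 0 equal to zero by \<open>dec0\<close>. Its other coordinates have the same image
    under \<open>w\<close>, namely zero, and vanish by \<open>w_inj\<close>.\<close>
  have "card K \<le> card (\<Pi>\<^sub>E i \<in> {..p}. V i)"
  proof (rule card_inj_on_le)
    show "inj_on (\<lambda>x. \<lambda>i\<in>{..p}. y i x) K"
    proof (rule inj_onI)
      fix x x' assume x: "x \<in> K" "x' \<in> K" and eq: "(\<lambda>i\<in>{..p}. y i x) = (\<lambda>i\<in>{..p}. y i x')"
      have yeq: "y i x = y i x'" if "i \<le> p" for i
        using fun_cong[OF eq, of i] that by simp
      define d where "d = x - x'"
      have d: "d \<in> M"
        using x by (auto simp: d_def K_def intro!: subgroup_ofD(2)[OF M(1)])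
      have "d \<in> K"
        using x d additive.diff[OF \<open>additive g\<close>, of x x'] by (auto simp: d_def K_def)
      have "y i d = 0" if "i \<le> p" for i
        using that yeq by (simp add: d_def addy)
      then have "d 0 = 0"
        using dec0 d by auto
      then have "w (single 0 (d 0)) = 0"
        by (simp add: w.zero)
      then have "w (single i (d i)) = 0" if "i \<le> p" for i
        using KW[OF \<open>d \<in> K\<close> that] by simp
      then have "d i = 0" if "i \<le> p" for i
        by (rule w_inj[OF that MX[OF d that]]) (rule that)
      then have "d = 0"
        using d by (intro ext, rename_tac i, case_tac "i \<le> p") (simp_all add: M_def tuples_def)
      then show "x = x'"
        by (simp add: d_def)
    qed
    show "(\<lambda>x. \<lambda>i\<in>{..p}. y i x) ` K \<subseteq> (\<Pi>\<^sub>E i \<in> {..p}. V i)"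
      by (intro image_subsetI restrict_PiE_iff[THEN iffD2] ballI yV) simp_all
    show "finite (\<Pi>\<^sub>E i \<in> {..p}. V i)"
      using finV by (simp add: finite_PiE)
  qed
  then have K: "card K \<le> (\<Prod>i\<le>p. card (V i))"
    by (simp add: card_PiE)
  \<comment> \<open>The exponents are \<open>(p + 1) + 2 * (p + 1)\<close> for \<open>card X\<close>
    and \<open>p + 2 * (p + 1)\<close> for \<open>card Y\<close>.\<close>
  have "card X ^ (3 * (p + 1)) = card M * (card X ^ 2) ^ (p + 1)"
    unfolding M(3) power_mult[symmetric] power_add[symmetric]
    by (rule arg_cong[where f = "power (card X)"]) simp
  also have "\<dots> \<le> card Y ^ p * (\<Prod>i\<le>p. card (V i)) * (card X ^ 2) ^ (p + 1)"
    using order_trans[OF MK mult_le_mono2[OF K]] by (rule mult_le_mono1)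
  also have "\<dots> = card Y ^ p * (\<Prod>i\<le>p. card (V i) * card X ^ 2)"
    by (simp only: prod.distrib prod_constant card_atMost Suc_eq_plus1 mult.assoc)
  also have "\<dots> \<le> card Y ^ p * (\<Prod>i\<le>p. card Y ^ 2)"
    by (intro mult_le_mono order_refl prod_mono) (use V in auto)
  also have "\<dots> = card Y ^ (3 * (p + 1) - 1)"
    unfolding prod_constant card_atMost power_mult[symmetric] power_add[symmetric]
    by (rule arg_cong[where f = "power (card Y)"]) simp
  finally show ?thesis .
qed

section \<open>Torsion and invertibility of primes in finite rings\<close>

text \<open>Cauchy's theorem for the additive group, written multiplicatively as \<open>G\<close>:
  Sylow's theorem with exponent 1 gives a subgroup of order \<open>p\<close>, and all its elements
  are killed by \<open>p\<close>.\<close>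

lemma torsion_exists:
  assumes "prime p" "p dvd CARD('s::{finite, ring_1})"
  shows "\<exists>x::'s. x \<noteq> 0 \<and> of_nat p * x = 0"
proof -
  define G :: "'s monoid" where "G = \<lparr>carrier = UNIV, mult = (+), one = 0\<rparr>"
  have pow: "x [^]\<^bsub>G\<^esub> (n::nat) = of_nat n * x" for x n
    by (induction n) (auto simp: G_def nat_pow_def algebra_simps)
  have "group G"
    by (rule groupI) (auto simp: G_def add.assoc intro: exI[of _ "- x" for x] left_minus)
  obtain q where q: "order G = p ^ 1 * q"
    using assms(2) by (auto simp: order_def G_def)
  then obtain H where H: "subgroup H G" "card H = p ^ 1"
    using sylow_thm[OF assms(1) \<open>group G\<close> q] by (auto simp: G_def)
  have "\<not> H \<subseteq> {0}"
    using H(2) prime_gt_1_nat[OF assms(1)] card_mono[of "{0}" H] by auto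
  then obtain x where x: "x \<in> H" "x \<noteq> 0"
    by auto
  interpret K: group "G\<lparr>carrier := H\<rparr>"
    using H(1) \<open>group G\<close> by (rule subgroup.subgroup_is_group)
  have "x [^]\<^bsub>G\<lparr>carrier := H\<rparr>\<^esub> order (G\<lparr>carrier := H\<rparr>) = \<one>\<^bsub>G\<lparr>carrier := H\<rparr>\<^esub>"
    by (rule K.pow_order_eq_1) (use x in simp)
  then have "x [^]\<^bsub>G\<^esub> p = 0"
    using H(2) by (simp add: order_def nat_pow_def G_def)
  then show ?thesis
    using x pow by auto
qed

text \<open>An inverse of \<open>p\<close> modulo \<open>CARD('r)\<close> is also one modulo the
  characteristic, which divides \<open>CARD('r)\<close>.\<close>

lemma of_nat_prime_invertible:
  assumes "prime p" "\<not> p dvd CARD('r::{finite, ring_1})"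
  shows "\<exists>c::'r. c * of_nat p = 1"
proof -
  have "coprime p CARD('r)"
    using assms by (simp add: prime_imp_coprime)
  then obtain u where "[p * u = 1] (mod CARD('r))"
    using cong_solve_coprime_nat by fastforce
  then have "[p * u = 1] (mod CHAR('r))"
    using CHAR_dvd_CARD cong_dvd_modulus_nat by blast
  then have "(of_nat (p * u) :: 'r) = of_nat 1"
    by (simp only: of_nat_eq_iff_cong_CHAR)
  then have "of_nat u * of_nat p = (1::'r)"
    unfolding of_nat_mult[symmetric] mult.commute[of p u] by simp
  then show ?thesis ..
qed

section \<open>Carried vectors of linear codes\<close>

text \<open>Additivity is what the upper bound takes from linearity. The sum is a separate family
  \<open>x''\<close>, related to the others on valid indices only, because the pointwise sum of
  extensional families need not be extensional.\<close>

lemma two_sided_linear_add: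
  fixes f :: "('i \<Rightarrow> nat \<Rightarrow> 'a::ring_1) \<Rightarrow> nat \<Rightarrow> 'a"
  assumes f: "two_sided_linear I d m f" and t: "t < m"
    and x: "x \<in> (\<Pi>\<^sub>E u \<in> I. vectors (d u))" "x' \<in> (\<Pi>\<^sub>E u \<in> I. vectors (d u))"
      "x'' \<in> (\<Pi>\<^sub>E u \<in> I. vectors (d u))"
    and add: "\<And>u j. u \<in> I \<Longrightarrow> j < d u \<Longrightarrow> x'' u j = x u j + x' u j"
  shows "f x'' t = f x t + f x' t"
proof -
  obtain L :: "'i \<Rightarrow> nat \<Rightarrow> nat" and a b where
    "\<forall>x \<in> (\<Pi>\<^sub>E u \<in> I. vectors (d u)).
      f x t = (\<Sum>u \<in> I. \<Sum>j < d u. \<Sum>l < L u j. a u j l * x u j * b u j l)"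
    using f[unfolded two_sided_linear_def, rule_format, OF t] by (elim exE)
  note f = this[rule_format]
  have "f x'' t = (\<Sum>u \<in> I. \<Sum>j < d u. \<Sum>l < L u j.
      a u j l * x u j * b u j l + a u j l * x' u j * b u j l)"
    unfolding f[OF x(3)] by (intro sum.cong refl) (simp add: add algebra_simps)
  then show ?thesis
    unfolding f[OF x(1)] f[OF x(2)] by (simp add: sum.distrib)
qed

text \<open>Induction downstream from the sources: a finite acyclic relation is well-founded, and
  arcs are compared through their tails.\<close>

lemma arc_induct:
  assumes "is_network N" "e \<in> arcs (dag N)"
    and step: "\<And>e. e \<in> arcs (dag N) \<Longrightarrow> (\<And>d. d \<in> in_arcs (dag N) (tail (dag N) e) \<Longrightarrow> P d) \<Longrightarrow> P e"
  shows "P e"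
proof -
  let ?G = "dag N"
  have "finite (arcs_ends ?G)"
    using assms(1) by (auto simp: is_network_def arcs_ends_def fin_digraph.finite_arcs)
  then have "wf (inv_image (arcs_ends ?G) (tail ?G))"
    using assms(1) by (intro wf_inv_image finite_acyclic_wf) (auto simp: is_network_def)
  then show ?thesis
    using assms(2)
  proof (induction e rule: wf_induct_rule)
    case (less e)
    show ?case
      by (rule step) (use less in \<open>force simp: arcs_ends_conv\<close>)+
  qed
qed

text \<open>Cuts an arbitrary family down to an admissible message, so that messages can be added in
  the full function type.\<close>

definition message_ext ::
    "('v, 'e) network \<Rightarrow> (nat \<Rightarrow> nat) \<Rightarrow> (nat \<Rightarrow> nat \<Rightarrow> 'a) \<Rightarrow> nat \<Rightarrow> nat \<Rightarrow> 'a" where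
  "message_ext N k x = (\<lambda>i \<in> {..<num_messages N}. \<lambda>j \<in> {..<k i}. x i j)"

definition arc_vec ::
    "('v, 'e) network \<Rightarrow> (nat \<Rightarrow> nat) \<Rightarrow> ('v, 'e, 'a) code \<Rightarrow> (nat \<Rightarrow> nat \<Rightarrow> 'a) \<Rightarrow> 'e \<Rightarrow> nat \<Rightarrow> 'a"
  where "arc_vec N k C x = (SOME z. carried N C (message_ext N k x) z)"

text \<open>Padding with \<open>0\<close> instead of \<open>undefined\<close> makes the carried
  vector additive as an element of the function type.\<close>

definition arc_value ::
    "('v, 'e) network \<Rightarrow> (nat \<Rightarrow> nat) \<Rightarrow> nat \<Rightarrow> ('v, 'e, 'a::ring_1) code \<Rightarrow>
       'e \<Rightarrow> (nat \<Rightarrow> nat \<Rightarrow> 'a) \<Rightarrow> nat \<Rightarrow> 'a"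
  where "arc_value N k n C e x = (\<lambda>t. if t < n then arc_vec N k C x e t else 0)"

lemma message_ext_in: "message_ext N k x \<in> (\<Pi>\<^sub>E i \<in> {..<num_messages N}. vectors (k i))"
  by (auto simp: message_ext_def vectors_def)

lemma carried_arc_vec:
  assumes "is_network N"
  shows "carried N C (message_ext N k x) (arc_vec N k C x)"
  unfolding arc_vec_def using ex1_carried[OF assms] by (metis someI_ex)

lemma node_input_in:
  assumes "x \<in> (\<Pi>\<^sub>E i \<in> {..<num_messages N}. vectors (k i))"
    and "\<And>d. d \<in> in_arcs (dag N) v \<Longrightarrow> z d \<in> vectors n"
  shows "node_input N x z v \<in> input_space N k n v"
  using assms by (auto simp: node_input_def input_space_def inputs_def)

lemma carried_in_vectors:
  assumes "is_network N" "is_code N k n C"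
    and x: "x \<in> (\<Pi>\<^sub>E i \<in> {..<num_messages N}. vectors (k i))" "carried N C x z"
    and "e \<in> arcs (dag N)"
  shows "z e \<in> vectors n"
  using assms(1,5)
proof (rule arc_induct)
  fix e assume e: "e \<in> arcs (dag N)" "\<And>d. d \<in> in_arcs (dag N) (tail (dag N) e) \<Longrightarrow> z d \<in> vectors n"
  then have "node_input N x z (tail (dag N) e) \<in> input_space N k n (tail (dag N) e)"
    by (intro node_input_in x)
  then show "z e \<in> vectors n"
    using e x(2) assms(2) by (auto simp: carried_def is_code_def)
qed

locale linear_network_code =
  fixes N :: "('v, 'e) network" and k :: "nat \<Rightarrow> nat" and n :: nat
    and C :: "('v, 'e, 'a::{finite, ring_1}) code"
  assumes network: "is_network N" and solution: "is_solution N k n C"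
    and linear: "two_sided_linear_code N k n C"
begin

lemma code: "is_code N k n C"
  using solution by (simp add: is_solution_def)

lemma arc_vec_in: "e \<in> arcs (dag N) \<Longrightarrow> arc_vec N k C x e \<in> vectors n"
  using carried_in_vectors[OF network code message_ext_in carried_arc_vec[OF network]] .

text \<open>If the values on all incoming arcs are additive in the message, then so is the node
  input on valid indices, and the edge function preserves sums.\<close>

lemma additive_arc_value:
  assumes "e \<in> arcs (dag N)"
  shows "additive (arc_value N k n C e)"
proof
  fix x x'
  let ?z = "arc_vec N k C"
  have "\<forall>t<n. ?z (x + x') e t = ?z x e t + ?z x' e t"
    using network assms
  proof (rule arc_induct)
    fix e assume e: "e \<in> arcs (dag N)"
      and IH: "\<And>d. d \<in> in_arcs (dag N) (tail (dag N) e) \<Longrightarrow>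
        \<forall>t<n. ?z (x + x') d t = ?z x d t + ?z x' d t"
    let ?v = "tail (dag N) e"
    define inp where "inp x = node_input N (message_ext N k x) (?z x) ?v" for x
    have inp: "inp x \<in> (\<Pi>\<^sub>E u \<in> inputs N ?v. vectors (input_dim k n u))" for x
      unfolding inp_def input_space_def[symmetric]
      by (rule node_input_in) (auto simp: message_ext_in intro: arc_vec_in)
    have z: "?z x e = edge_fun C e (inp x)" for x
      using carried_arc_vec[OF network] e by (auto simp: carried_def inp_def)
    have add: "inp (x + x') u j = inp x u j + inp x' u j"
      if "u \<in> inputs N ?v" "j < input_dim k n u" for u j
      using that IH by (auto simp: inp_def node_input_def inputs_def message_ext_def)
    have "two_sided_linear (inputs N ?v) (input_dim k n) n (edge_fun C e)"
      using linear e by (auto simp: two_sided_linear_code_def)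
    then show "\<forall>t<n. ?z (x + x') e t = ?z x e t + ?z x' e t"
      unfolding z using two_sided_linear_add[OF _ _ inp inp inp add] by blast
  qed
  then show "arc_value N k n C e (x + x') = arc_value N k n C e x + arc_value N k n C e x'"
    by (auto simp: arc_value_def fun_eq_iff)
qed

lemma node_input_eq:
  assumes "\<And>i. i < num_messages N \<Longrightarrow> origin N i = v \<Longrightarrow> message_ext N k x i = message_ext N k x' i"
    and "\<And>d. d \<in> in_arcs (dag N) v \<Longrightarrow> arc_value N k n C d x = arc_value N k n C d x'"
  shows "node_input N (message_ext N k x) (arc_vec N k C x) v =
    node_input N (message_ext N k x') (arc_vec N k C x') v"
proof -
  have "arc_vec N k C x d = arc_vec N k C x' d" if d: "d \<in> in_arcs (dag N) v" for d
  proof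
    fix t
    have "arc_vec N k C x d \<in> vectors n" "arc_vec N k C x' d \<in> vectors n"
      using d by (auto intro: arc_vec_in)
    then show "arc_vec N k C x d t = arc_vec N k C x' d t"
      using fun_cong[OF assms(2)[OF d], of t]
      by (auto simp: arc_value_def vectors_def PiE_iff extensional_def split: if_splits)
  qed
  then show ?thesis
    using assms(1) by (auto simp: node_input_def inputs_def restrict_def fun_eq_iff)
qed

text \<open>Locality: through this lemma and \<open>message_eq\<close>, the shape of the network
  becomes dependence between values of \<open>arc_value\<close>, with no further reference to edge
  and decoding functions.\<close>

lemma arc_value_eq:
  assumes "e \<in> arcs (dag N)"
    and "\<And>i. i < num_messages N \<Longrightarrow> origin N i = tail (dag N) e \<Longrightarrow>
      message_ext N k x i = message_ext N k x' i"
    and "\<And>d. d \<in> in_arcs (dag N) (tail (dag N) e) \<Longrightarrow> arc_value N k n C d x = arc_value N k n C d x'"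
  shows "arc_value N k n C e x = arc_value N k n C e x'"
proof -
  have "arc_vec N k C x e = edge_fun C e
      (node_input N (message_ext N k x) (arc_vec N k C x) (tail (dag N) e))" for x
    using carried_arc_vec[OF network] assms(1) by (auto simp: carried_def)
  then have "arc_vec N k C x e = arc_vec N k C x' e"
    using node_input_eq[OF assms(2,3)] by metis
  then show ?thesis
    by (auto simp: arc_value_def)
qed

text \<open>A correct decoder that receives the same input for two messages must output the same
  vector for both.\<close>

lemma message_eq:
  assumes "v \<in> receivers N" "i \<in> demands N v"
    and "\<And>j. j < num_messages N \<Longrightarrow> origin N j = v \<Longrightarrow> message_ext N k x j = message_ext N k x' j"
    and "\<And>d. d \<in> in_arcs (dag N) v \<Longrightarrow> arc_value N k n C d x = arc_value N k n C d x'"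
  shows "message_ext N k x i = message_ext N k x' i"
proof -
  have "decode_fun C v i (node_input N (message_ext N k x) (arc_vec N k C x) v) =
      message_ext N k x i" for x
    using solution assms(1,2) message_ext_in carried_arc_vec[OF network]
    unfolding is_solution_def by blast
  then show ?thesis
    using node_input_eq[OF assms(3,4)] by metis
qed

end

section \<open>The network\<close>

text \<open>
  Level 0 holds the sources, level 3 the receivers.  For \<open>i \<le> p\<close> the arc from \<open>node 1 i\<close> to \<open>node 2 i\<close>
  is the bottleneck for \<open>y\<^sub>i\<close>, and for \<open>i = p + 1\<close> it is the bottleneck for \<open>w\<close>.
\<close>

definition node :: "nat \<Rightarrow> nat \<Rightarrow> nat" where
  "node l i = prod_encode (l, i)"

definition level :: "nat \<Rightarrow> nat" where "level v = fst (prod_decode v)"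
definition position :: "nat \<Rightarrow> nat" where "position v = snd (prod_decode v)"

lemma node_simps [simp]:
  "level (node l i) = l" "position (node l i) = i" "node l i = node l' i' \<longleftrightarrow> l = l' \<and> i = i'"
  by (auto simp: node_def level_def position_def)

definition arc :: "nat \<Rightarrow> nat \<Rightarrow> nat" where
  "arc u v = prod_encode (u, v)"

definition arc_tail :: "nat \<Rightarrow> nat" where "arc_tail e = fst (prod_decode e)"
definition arc_head :: "nat \<Rightarrow> nat" where "arc_head e = snd (prod_decode e)"

lemma arc_simps [simp]:
  "arc_tail (arc u v) = u" "arc_head (arc u v) = v" "arc u v = arc u' v' \<longleftrightarrow> u = u' \<and> v = v'"
  by (auto simp: arc_def arc_tail_def arc_head_def)

text \<open>As \<open>j \<le> p\<close>, the condition \<open>j \<noteq> i\<close> omits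
  \<open>x\<^sub>i\<close> for \<open>i \<le> p\<close> and nothing for \<open>i = Suc p\<close>; so
  one family of arcs feeds both the \<open>y\<^sub>i\<close> and \<open>w\<close>.\<close>

definition char_arcs :: "nat \<Rightarrow> nat set" where
  "char_arcs p =
     {arc (node 0 j) (node 1 i) | i j. j \<le> p \<and> i \<le> Suc p \<and> j \<noteq> i} \<union>
     {arc (node 1 i) (node 2 i) | i. i \<le> Suc p} \<union>
     {arc (node 2 j) (node 3 i) | i j. i \<le> p \<and> (j = i \<or> j = Suc p)} \<union>
     {arc (node 2 j) (node 3 (Suc p)) | j. j \<le> p}"

definition char_network :: "nat \<Rightarrow> (nat, nat) network" where
  "char_network p =
     \<lparr>dag = \<lparr>verts = {node l i | l i. l \<le> 3 \<and> i \<le> Suc p}, arcs = char_arcs p,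
             tail = arc_tail, head = arc_head\<rparr>,
      sources = node 0 ` {..p}, receivers = node 3 ` {..Suc p}, num_messages = Suc p,
      origin = node 0, demands = (\<lambda>v. if position v \<le> p then {position v} else {0})\<rparr>"

lemma char_network_simps [simp]:
  "verts (dag (char_network p)) = {node l i | l i. l \<le> 3 \<and> i \<le> Suc p}"
  "arcs (dag (char_network p)) = char_arcs p"
  "tail (dag (char_network p)) = arc_tail" "head (dag (char_network p)) = arc_head"
  "sources (char_network p) = node 0 ` {..p}" "receivers (char_network p) = node 3 ` {..Suc p}"
  "num_messages (char_network p) = Suc p" "origin (char_network p) = node 0"
  "demands (char_network p) v = (if position v \<le> p then {position v} else {0})"
  by (simp_all add: char_network_def)

lemma is_network_char_network: "is_network (char_network p)"
proof -
  have verts: "{node l i | l i. l \<le> 3 \<and> i \<le> Suc p} = case_prod node ` ({..3} \<times> {..Suc p})"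
    by auto
  have "char_arcs p \<subseteq> case_prod arc ` (verts (dag (char_network p)) \<times> verts (dag (char_network p)))"
    by (auto simp: char_arcs_def)
  moreover have fin: "finite (verts (dag (char_network p)))"
    unfolding char_network_simps verts by simp
  ultimately have "finite (char_arcs p)"
    by (meson finite_SigmaI finite_imageI finite_subset)
  then have "fin_digraph (dag (char_network p))"
    using fin by unfold_locales (auto simp: char_arcs_def)
  \<comment> \<open>Every arc raises \<open>level\<close>, which excludes cycles.\<close>
  moreover have "arcs_ends (dag (char_network p)) \<subseteq> measure level"
    by (auto simp: arcs_ends_conv char_arcs_def)
  then have "acyclic (arcs_ends (dag (char_network p)))"
    by (meson wf_acyclic wf_measure wf_subset)
  ultimately show ?thesis
    by (auto simp: is_network_def)
qed

lemma in_arcs_char_network: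
  "in_arcs (dag (char_network p)) (node 0 j) = {}"
  "i \<le> Suc p \<Longrightarrow> in_arcs (dag (char_network p)) (node 1 i) =
     (\<lambda>j. arc (node 0 j) (node 1 i)) ` ({..p} - {i})"
  "i \<le> Suc p \<Longrightarrow> in_arcs (dag (char_network p)) (node 2 i) = {arc (node 1 i) (node 2 i)}"
  "i \<le> p \<Longrightarrow> in_arcs (dag (char_network p)) (node 3 i) =
     {arc (node 2 i) (node 3 i), arc (node 2 (Suc p)) (node 3 i)}"
  "in_arcs (dag (char_network p)) (node 3 (Suc p)) = (\<lambda>j. arc (node 2 j) (node 3 (Suc p))) ` {..p}"
  by (auto simp: in_arcs_def char_arcs_def)

section \<open>Capacities of the network\<close>

lemma sum_const_fun_apply: "(\<Sum>i<p. f) x = (\<Sum>i<(p::nat). f x)"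
  by (induction p) auto

text \<open>On messages with entries in the \<open>p\<close>-torsion \<open>A\<close>, the code
  provides the data of \<open>broadcast_bound\<close>, with \<open>X\<close> and \<open>Y\<close>
  the \<open>K\<close>-tuples and \<open>n\<close>-tuples over \<open>A\<close>. As
  \<open>card A > 1\<close>, the resulting inequality of powers is one of exponents.\<close>

lemma char_network_linear_bound:
  fixes C :: "(nat, nat, 's::{finite, ring_1}) code"
  assumes p: "prime p" "p dvd CARD('s)"
    and solution: "is_solution (char_network p) k n C"
    and linear: "two_sided_linear_code (char_network p) k n C"
    and k: "\<And>i. i \<le> p \<Longrightarrow> k i = K"
  shows "3 * (p + 1) * K \<le> (3 * (p + 1) - 1) * n"
proof -
  let ?N = "char_network p"
  interpret linear_network_code ?N k n C
    by unfold_locales (fact is_network_char_network solution linear)+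
  define A where "A = {a :: 's. of_nat p * a = 0}"
  define X where "X = tuples {..<K} A"
  define Y where "Y = tuples {..<n} A"
  define val where "val = arc_value ?N k n C"
  define w where "w = val (arc (node 1 (Suc p)) (node 2 (Suc p)))"
  define y where "y i = val (arc (node 1 i) (node 2 i))" for i
  let ?M = "tuples {..p} X"
  have A: "subgroup_of A"
    by (auto simp: A_def subgroup_of_def right_diff_distrib)
  have ext_eq: "message_ext ?N k x i = message_ext ?N k x' i" if "x i = x' i" for x x' i
    using that by (auto simp: message_ext_def restrict_def fun_eq_iff)
  have ext_eqD: "x i = x' i"
    if "message_ext ?N k x i = message_ext ?N k x' i" "x \<in> ?M" "x' \<in> ?M" "i \<le> p" for x x' i
  proof
    fix j
    show "x i j = x' i j"
      using fun_cong[OF that(1), of j] that(2-) k[OF that(4)]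
      by (cases "j < K") (auto simp: message_ext_def tuples_def X_def)
  qed
  have additive_val: "additive (val e)" if "e \<in> char_arcs p" for e
    unfolding val_def by (rule additive_arc_value) (use that in simp)
  have val_in: "val e x \<in> Y" if e: "e \<in> char_arcs p" and x: "x \<in> ?M" for e x
  proof -
    \<comment> \<open>Additive maps send \<open>p\<close>-torsion to \<open>p\<close>-torsion, so
      the carried entries stay in \<open>A\<close>.\<close>
    have "(\<Sum>i<p. x) = 0"
    proof (intro ext)
      fix i j
      show "(\<Sum>i<p. x) i j = 0 i j"
        using x by (cases "i \<le> p"; cases "j < K")
          (auto simp: sum_const_fun_apply tuples_def X_def A_def)
    qed
    then have "(\<Sum>i<p. val e x) = 0"
      using additive.sum[OF additive_val[OF e], of "\<lambda>i. x" "{..<p}"]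
        additive.zero[OF additive_val[OF e]] by simp
    then have "val e x t \<in> A" for t
      using sum_const_fun_apply[where f = "val e x" and p = p and x = t] by (simp add: A_def)
    moreover have "val e x t = 0" if "\<not> t < n" for t
      using that by (simp add: val_def arc_value_def)
    ultimately show ?thesis
      by (simp add: Y_def tuples_def)
  qed
  have up: "arc (node 1 i) (node 2 i) \<in> char_arcs p" if "i \<le> Suc p" for i
    using that by (auto simp: char_arcs_def)
  \<comment> \<open>An arc out of a bottleneck may apply a further function, but its value still
    depends only on what the bottleneck carries.\<close>
  have relay: "val (arc (node 2 j) v) x = val (arc (node 2 j) v) x'"
    if "arc (node 2 j) v \<in> char_arcs p"
      "val (arc (node 1 j) (node 2 j)) x = val (arc (node 1 j) (node 2 j)) x'" for j v x x'
  proof -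
    have "j \<le> Suc p"
      using that(1) by (auto simp: char_arcs_def)
    then show ?thesis
      using that unfolding val_def by - (rule arc_value_eq, auto simp: in_arcs_char_network)
  qed
  have zero: "val (arc (node 1 i) (node 2 i)) 0 = 0" if "i \<le> Suc p" for i
    using additive.zero[OF additive_val[OF up[OF that]]] .
  have zero_in: "0 \<in> ?M"
    using A by (auto simp: subgroup_of_tuples X_def intro!: subgroup_ofD(1))
  have "card X ^ (3 * (p + 1)) \<le> card Y ^ (3 * (p + 1) - 1)"
  proof (rule broadcast_bound[where w = w and y = y])
    show "p \<ge> 1"
      using prime_ge_1_nat p(1) .
    show "(\<Sum>i<p. c) = 0" if "c \<in> Y" for c
    proof
      fix t
      show "(\<Sum>i<p. c) t = 0 t"
        using that by (cases "t < n") (auto simp: sum_const_fun_apply Y_def tuples_def A_def)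
    qed
    show "subgroup_of X" "finite X" "subgroup_of Y" "finite Y"
      using A by (simp_all add: X_def Y_def subgroup_of_tuples finite_tuples)
    show "additive w" "w ` ?M \<subseteq> Y"
      using up[of "Suc p"] by (auto simp: w_def intro: additive_val val_in)
    show "additive (y i)" "y i ` ?M \<subseteq> Y" if "i \<le> p" for i
      using up[of i] that by (auto simp: y_def intro: additive_val val_in)
    show "y i (single i a) = 0" if i: "i \<le> p" for i a
    proof -
      have "y i (single i a) = y i 0"
        unfolding y_def val_def
      proof (rule arc_value_eq)
        show "arc (node 1 i) (node 2 i) \<in> arcs (dag ?N)"
          using up[of i] i by simp
        fix d assume "d \<in> in_arcs (dag ?N) (tail (dag ?N) (arc (node 1 i) (node 2 i)))"
        then obtain j where j: "j \<le> p" "j \<noteq> i" and d: "d = arc (node 0 j) (node 1 i)"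
          using i by (auto simp: in_arcs_char_network(2)[of i p] simp del: One_nat_def)
        show "arc_value ?N k n C d (single i a) = arc_value ?N k n C d 0"
        proof (rule arc_value_eq)
          show "d \<in> arcs (dag ?N)"
            using i j by (auto simp: d char_arcs_def)
          fix j' assume "origin ?N j' = tail (dag ?N) d"
          then have "j' = j"
            by (simp add: d)
          then show "message_ext ?N k (single i a) j' = message_ext ?N k 0 j'"
            using j(2) by (intro ext_eq) simp
        qed (simp add: d in_arcs_char_network)
      qed simp
      then show ?thesis
        using zero i by (simp add: y_def)
    qed
    show "x i = 0" if x: "x \<in> ?M" "i \<le> p" "w x = 0" "y i x = 0" for x i
    proof -
      \<comment> \<open>The receiver cannot distinguish \<open>x\<close> from the zero message,
        because \<open>w\<close> and \<open>y i\<close> vanish on both.\<close>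
      have "message_ext ?N k x i = message_ext ?N k 0 i"
      proof (rule message_eq)
        show "node 3 i \<in> receivers ?N" "i \<in> demands ?N (node 3 i)"
          using x(2) by auto
        show "arc_value ?N k n C d x = arc_value ?N k n C d 0"
          if "d \<in> in_arcs (dag ?N) (node 3 i)" for d
          using that x zero unfolding val_def[symmetric]
          by (auto simp: in_arcs_char_network w_def y_def char_arcs_def intro!: relay)
      qed auto
      then show ?thesis
        using ext_eqD[of x i 0] x zero_in by simp
    qed
    show "x 0 = 0" if x: "x \<in> ?M" "\<And>i. i \<le> p \<Longrightarrow> y i x = 0" for x
    proof -
      have "message_ext ?N k x 0 = message_ext ?N k 0 0"
      proof (rule message_eq)
        show "node 3 (Suc p) \<in> receivers ?N" "0 \<in> demands ?N (node 3 (Suc p))"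
          by auto
        show "arc_value ?N k n C d x = arc_value ?N k n C d 0"
          if "d \<in> in_arcs (dag ?N) (node 3 (Suc p))" for d
          using that x zero unfolding val_def[symmetric]
          by (auto simp: in_arcs_char_network y_def char_arcs_def intro!: relay)
      qed auto
      then show ?thesis
        using ext_eqD[of x 0 0] x zero_in by simp
    qed
  qed
  moreover have "card X = card A ^ K" "card Y = card A ^ n"
    by (simp_all add: X_def Y_def card_tuples)
  ultimately have "card A ^ (K * (3 * (p + 1))) \<le> card A ^ (n * (3 * (p + 1) - 1))"
    by (simp only: power_mult)
  moreover have "card A > 1"
  proof -
    obtain a :: 's where "a \<noteq> 0" "of_nat p * a = 0"
      using torsion_exists[OF p] by auto
    then have "card {0, a} \<le> card A"
      by (intro card_mono) (auto simp: A_def)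
    then show ?thesis
      using \<open>a \<noteq> 0\<close> by simp
  qed
  ultimately have "K * (3 * (p + 1)) \<le> n * (3 * (p + 1) - 1)"
    using power_le_imp_le_exp by blast
  then show ?thesis
    by (simp only: mult.commute)
qed

corollary linear_capacity_char_network_le:
  assumes "prime p" "p dvd CARD('s::{finite, ring_1})"
  shows "linear_capacity TYPE('s) (char_network p) \<le> ereal (1 - 1 / (3 * (real p + 1)))"
  unfolding linear_capacity_def
proof (rule Sup_least)
  fix u assume "u \<in> {ereal (real_of_rat r) |r.
    linearly_achievable TYPE('s) (char_network p) (\<lambda>i. r)}"
  then obtain r where u: "u = ereal (real_of_rat r)"
    and "linearly_achievable TYPE('s) (char_network p) (\<lambda>i. r)"
    by blast
  then obtain k n and C :: "(nat, nat, 's) code" where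
    C: "is_solution (char_network p) k n C" "two_sided_linear_code (char_network p) k n C"
    and r: "\<And>i. i \<le> p \<Longrightarrow> r = of_nat (k i) / of_nat n"
    by (auto simp: linearly_achievable_def less_Suc_eq_le)
  have n: "n \<ge> 1"
    using C(1) by (simp add: is_solution_def is_code_def)
  \<comment> \<open>A common rate over the same positive \<open>n\<close> forces equal message
    lengths.\<close>
  have "k i = k 0" if "i \<le> p" for i
    using r[OF that] r[of 0] n by simp
  from char_network_linear_bound[OF assms C this]
  have "real (3 * (p + 1) * k 0) \<le> real ((3 * (p + 1) - 1) * n)"
    by (simp only: of_nat_le_iff)
  then have "k 0 / n \<le> (3 * (real p + 1) - 1) / (3 * (real p + 1))"
    using n by (simp add: field_simps)
  also have "\<dots> = 1 - 1 / (3 * (real p + 1))"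
    by (simp add: field_simps)
  finally show "u \<le> ereal (1 - 1 / (3 * (real p + 1)))"
    using r[of 0] by (simp only: u of_rat_divide of_rat_of_nat_eq ereal_less_eq)
qed

section \<open>Rate 1 when \<open>p\<close> is invertible\<close>

lemma linear_capacity_char_network_ge:
  assumes "prime p" "\<not> p dvd CARD('r::{finite, ring_1})"
  shows "linear_capacity TYPE('r) (char_network p) \<ge> 1"
proof -
  let ?N = "char_network p"
  obtain c :: 'r where c: "c * of_nat p = 1"
    using of_nat_prime_invertible[OF assms] by blast
  \<comment> \<open>At receiver \<open>i \<le> p\<close> these coefficients form
    \<open>w - y\<^sub>i\<close>. At receiver \<open>p + 1\<close> they form
    \<open>c * (y\<^sub>0 + ... + y\<^sub>p) - y\<^sub>0\<close>, which is
    \<open>s - (s - x\<^sub>0)\<close> for the sum \<open>s\<close> of all messages.\<close>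
  define coef :: "nat \<Rightarrow> nat input \<Rightarrow> 'r" where
    "coef v u = (case u of Message i \<Rightarrow> 0 | Edge d \<Rightarrow>
       let j = position (arc_tail d) in
       if position v \<le> p then (if j = Suc p then 1 else -1)
       else c - (if j = 0 then 1 else 0))" for v u
  define C :: "(nat, nat, 'r) code" where
    "C = \<lparr>edge_fun = (\<lambda>e inp. \<lambda>t\<in>{..<1}. \<Sum>u\<in>inputs ?N (arc_tail e). inp u 0),
          decode_fun = (\<lambda>v i inp. \<lambda>t\<in>{..<1}. \<Sum>u\<in>inputs ?N v. coef v u * inp u 0)\<rparr>"
  let ?k = "\<lambda>i::nat. 1::nat"
  have dim: "input_dim ?k 1 = (\<lambda>u::nat input. 1)"
    by (rule ext, rename_tac u, case_tac u) auto
  have linear_form: "two_sided_linear I (\<lambda>u. 1) 1 (\<lambda>inp. \<lambda>t\<in>{..<1}. \<Sum>u\<in>I. b u * inp u 0)"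
    for I and b :: "nat input \<Rightarrow> 'r"
    unfolding two_sided_linear_def
    by (intro allI impI exI[of _ "\<lambda>u j. 1"] exI[of _ "\<lambda>u j l. b u"] exI[of _ "\<lambda>u j l. 1"]) simp
  have linear: "two_sided_linear_code ?N ?k 1 C"
    unfolding two_sided_linear_code_def dim
    using linear_form[of _ "\<lambda>u. 1"] linear_form by (simp add: C_def)
  have code: "is_code ?N ?k 1 C"
    by (auto simp: is_code_def C_def vectors_def)
  have solution: "is_solution ?N ?k 1 C"
    unfolding is_solution_def
  proof (intro conjI ballI allI impI code)
    fix x z v i
    assume x: "x \<in> (\<Pi>\<^sub>E i \<in> {..<num_messages ?N}. vectors 1)" and "carried ?N C x z"
      and v: "v \<in> receivers ?N" "i \<in> demands ?N v"
    define inp where "inp = node_input ?N x z"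
    \<comment> \<open>Messages originate at level 0 only, so nodes of higher level have only arcs as
      inputs.\<close>
    have Edge_sum: "(\<Sum>u\<in>inputs ?N (node (Suc l) i). g u) =
        (\<Sum>d\<in>in_arcs (dag ?N) (node (Suc l) i). g (Edge d))" for l i and g :: "nat input \<Rightarrow> 'r"
      by (subst sum.reindex[symmetric, unfolded o_def]) (auto simp: inputs_def inj_on_def)
    have z: "z e 0 = (\<Sum>u\<in>inputs ?N (arc_tail e). inp (arc_tail e) u 0)" if "e \<in> char_arcs p" for e
      using \<open>carried ?N C x z\<close> that by (simp add: carried_def C_def inp_def)
    have inp_Edge: "inp v (Edge d) = z d" if "d \<in> in_arcs (dag ?N) v" for v d
      using that by (simp add: inp_def node_input_def inputs_def)
    have z_arc: "z (arc (node (Suc l) j) v) 0 = (\<Sum>d\<in>in_arcs (dag ?N) (node (Suc l) j). z d 0)"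
      if "arc (node (Suc l) j) v \<in> char_arcs p" for l j v
      using z[OF that] by (simp add: Edge_sum inp_Edge)
    have z0: "z (arc (node 0 j) (node 1 i)) 0 = x j 0" if "j \<le> p" "i \<le> Suc p" "j \<noteq> i" for i j
    proof -
      have "inputs ?N (node 0 j) = {Message j}"
        using that by (auto simp: inputs_def in_arcs_char_network)
      moreover have "arc (node 0 j) (node 1 i) \<in> char_arcs p"
        using that by (auto simp: char_arcs_def)
      ultimately show ?thesis
        using z by (simp add: inp_def node_input_def)
    qed
    have z1: "z (arc (node 1 i) (node 2 i)) 0 = (\<Sum>j\<in>{..p} - {i}. x j 0)" if "i \<le> Suc p" for i
    proof -
      have "arc (node 1 i) (node 2 i) \<in> char_arcs p"
        using that by (auto simp: char_arcs_def)
      then have "z (arc (node 1 i) (node 2 i)) 0 = (\<Sum>d\<in>in_arcs (dag ?N) (node 1 i). z d 0)"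
        using z_arc[of 0 i] by simp
      also have "\<dots> = (\<Sum>j\<in>{..p} - {i}. z (arc (node 0 j) (node 1 i)) 0)"
        using that by (simp only: in_arcs_char_network) (simp add: sum.reindex inj_on_def)
      also have "\<dots> = (\<Sum>j\<in>{..p} - {i}. x j 0)"
        using that by (intro sum.cong) (auto simp: z0 simp del: One_nat_def)
      finally show ?thesis .
    qed
    define s where "s = (\<Sum>j\<le>p. x j 0)"
    have z2: "z (arc (node 2 j) v) 0 = (if j \<le> p then s - x j 0 else s)"
      if "arc (node 2 j) v \<in> char_arcs p" for j v
    proof -
      have j: "j \<le> Suc p"
        using that by (auto simp: char_arcs_def)
      have "z (arc (node 2 j) v) 0 = (\<Sum>d\<in>in_arcs (dag ?N) (node 2 j). z d 0)"
        using z_arc[of 1 j] that by (simp add: numeral_2_eq_2)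
      also have "\<dots> = (\<Sum>i\<in>{..p} - {j}. x i 0)"
        using j by (simp add: in_arcs_char_network z1 del: One_nat_def)
      also have "\<dots> = (if j \<le> p then s - x j 0 else s)"
        by (simp add: s_def sum_diff1)
      finally show ?thesis .
    qed
    obtain m where m: "v = node 3 m" "m \<le> Suc p"
      using v(1) by auto
    have "decode_fun C v i (node_input ?N x z v) 0 = (\<Sum>u\<in>inputs ?N v. coef v u * inp v u 0)"
      by (simp add: C_def inp_def)
    also have "\<dots> = (\<Sum>d\<in>in_arcs (dag ?N) v. coef v (Edge d) * inp v (Edge d) 0)"
      using Edge_sum[where l = 2 and i = m and g = "\<lambda>u. coef v u * inp v u 0"]
      by (simp add: m(1) numeral_3_eq_3 numeral_2_eq_2)
    also have "\<dots> = (\<Sum>d\<in>in_arcs (dag ?N) (node 3 m). coef v (Edge d) * z d 0)"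
      by (simp only: inp_Edge m(1) cong: sum.cong)
    finally have dec: "decode_fun C v i (node_input ?N x z v) 0 =
        (\<Sum>d\<in>in_arcs (dag ?N) (node 3 m). coef v (Edge d) * z d 0)" .
    have "decode_fun C v i (node_input ?N x z v) 0 = x i 0"
    proof (cases "m \<le> p")
      case True
      then have "i = m"
        using v(2) m by simp
      have "arc (node 2 m) (node 3 m) \<in> char_arcs p" "arc (node 2 (Suc p)) (node 3 m) \<in> char_arcs p"
        using True by (auto simp: char_arcs_def)
      then show ?thesis
        unfolding dec using True \<open>i = m\<close> m
        by (simp add: in_arcs_char_network coef_def z2)
    next
      case False
      then have [simp]: "m = Suc p" "i = 0"
        using v(2) m by auto
      have "arc (node 2 j) (node 3 (Suc p)) \<in> char_arcs p" if "j \<le> p" for j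
        using that by (auto simp: char_arcs_def)
      then have "decode_fun C v i (node_input ?N x z v) 0 =
          (\<Sum>j\<le>p. (c - (if j = 0 then 1 else 0)) * (s - x j 0))"
        unfolding dec using m
        by (simp add: in_arcs_char_network sum.reindex inj_on_def coef_def z2)
      also have "\<dots> = c * (\<Sum>j\<le>p. s - x j 0) - (\<Sum>j\<le>p. if j = 0 then s - x j 0 else 0)"
        unfolding sum_distrib_left sum_subtractf[symmetric]
        by (intro sum.cong) (auto simp: algebra_simps)
      \<comment> \<open>Of the \<open>p + 1\<close> copies of \<open>s\<close>, one is cancelled by
        the sum of the \<open>x j 0\<close>; the left factor \<open>c\<close> then removes
        \<open>of_nat p\<close>.\<close>
      also have "(\<Sum>j\<le>p. s - x j 0) = of_nat p * s"
        by (simp add: sum_subtractf algebra_simps flip: s_def)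
      also have "c * (of_nat p * s) = s"
        using c by (simp flip: mult.assoc)
      finally show ?thesis
        by simp
    qed
    moreover have "x i \<in> vectors 1"
    proof (rule PiE_mem[OF x])
      show "i \<in> {..<num_messages ?N}"
        using v(2) by (simp split: if_splits)
    qed
    moreover have "decode_fun C v i (node_input ?N x z v) \<in> vectors 1"
      by (simp add: C_def vectors_def)
    ultimately show "decode_fun C v i (node_input ?N x z v) = x i"
      unfolding vectors_def by (intro PiE_ext[of _ "{..<1}"]) simp_all
  qed
  have "linearly_achievable TYPE('r) ?N (\<lambda>i. 1)"
    unfolding linearly_achievable_def using solution linear by force
  then have "ereal (real_of_rat 1) \<le> linear_capacity TYPE('r) ?N"
    unfolding linear_capacity_def by (intro Sup_upper) blast
  then show ?thesis
    by (simp add: one_ereal_def)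
qed

theorem corollary4p4:
  assumes "\<exists>p. prime p \<and> p dvd CARD('s::{finite, ring_1}) \<and> \<not> p dvd CARD('r::{finite, ring_1})"
  shows "\<exists>N :: (nat, nat) network. is_network N \<and>
           linear_capacity TYPE('r) N > linear_capacity TYPE('s) N"
proof -
  obtain p where p: "prime p" "p dvd CARD('s)" "\<not> p dvd CARD('r)"
    using assms by blast
  have "linear_capacity TYPE('s) (char_network p) \<le> ereal (1 - 1 / (3 * (real p + 1)))"
    using p by (intro linear_capacity_char_network_le)
  also have "\<dots> < 1"
    by (simp add: one_ereal_def)
  also have "\<dots> \<le> linear_capacity TYPE('r) (char_network p)"
    using p by (intro linear_capacity_char_network_ge)
  finally show ?thesis
    using is_network_char_network by blast
qed

end
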